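(* Let \(A\) be a real skew-symmetric \(n\times n\) matrix and let \(\mu_A\) be the probability distribution on subsets of \([n]\) with \(\mu_A(S)\propto\det(A_{S,S})\) (supported on even subsets). Fix a coordinate \(i\) such that both \(\{S:i\notin S\}\) and \(\{S:i\in S\}\) have positive \(\mu_A\)-mass. Then there is a coupling \((S_0,S_1)\) of the conditional laws \(\mu_A(\cdot\mid i\notin S)\) and \(\mu_A(\cdot\mid i\in S)\) such that almost surely \(i\notin S_0\), \(i\in S_1\), and \(|S_0\triangle S_1|=2\).
   Context: \(A_{S,S}\) is the principal submatrix of \(A\) on \(S\); the determinant of the empty matrix is \(1\). Principal determinants of a real skew-symmetric matrix are nonnegative and vanish for odd \(|S|\). *)

theory Defs
  imports
    "HOL-Probability.Probability_Mass_Function"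
    "Jordan_Normal_Form.Char_Poly"
    "Jordan_Normal_Form.DL_Submatrix"
begin

text \<open>
  An \<open>n \<times> n\<close> matrix has index set \<open>{..<n}\<close>, which plays the role of \<open>[n]\<close>.  The name
  \<open>Determinant.det\<close> is qualified because HOL-Analysis also has a constant \<open>det\<close>.
\<close>

definition skew_symmetric_mat :: "real mat \<Rightarrow> bool" where
  "skew_symmetric_mat A \<longleftrightarrow> transpose_mat A = - A"

definition principal_det :: "real mat \<Rightarrow> nat set \<Rightarrow> real" where
  "principal_det A S = Determinant.det (submatrix A S S)"

text \<open>
  The distribution with mass proportional to the principal determinants.  \<open>embed_pmf\<close> is
  meaningful only for a nonnegative function of total mass one; for skew-symmetric \<open>A\<close> this is
  the case, see \<open>pmf_principal_det_pmf\<close> below.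
\<close>

definition principal_det_pmf :: "real mat \<Rightarrow> nat set pmf" where
  "principal_det_pmf A = embed_pmf (\<lambda>S.
     if S \<subseteq> {..<dim_row A}
     then principal_det A S / (\<Sum>T\<in>Pow {..<dim_row A}. principal_det A T) else 0)"

definition is_coupling :: "('a \<times> 'b) pmf \<Rightarrow> 'a pmf \<Rightarrow> 'b pmf \<Rightarrow> bool" where
  "is_coupling Q p q \<longleftrightarrow> map_pmf fst Q = p \<and> map_pmf snd Q = q"

lemma skew_symmetric_det_nonneg:
  assumes A: "A \<in> carrier_mat n n" and skew: "skew_symmetric_mat A"
  shows "Determinant.det A \<ge> 0"
proof (rule ccontr)
  assume neg: "\<not> Determinant.det A \<ge> 0"
  have noroot: "poly (char_poly A) c \<noteq> 0" if c: "c > 0" for c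
  proof
    assume "poly (char_poly A) c = 0"
    then have "eigenvalue A c" using eigenvalue_root_char_poly[OF A] by simp
    then obtain v where v: "v \<in> carrier_vec n" "v \<noteq> 0\<^sub>v n" "A *\<^sub>v v = c \<cdot>\<^sub>v v"
      using A unfolding eigenvalue_def eigenvector_def by auto
    have "(transpose_mat A *\<^sub>v v) \<bullet> v = v \<bullet> (A *\<^sub>v v)"
      using transpose_vec_mult_scalar[OF A v(1) v(1)] .
    moreover have "transpose_mat A *\<^sub>v v = - (c \<cdot>\<^sub>v v)"
      using skew A v unfolding skew_symmetric_mat_def by auto
    ultimately have "- (c * (v \<bullet> v)) = c * (v \<bullet> v)" using v by simp
    then have "v \<bullet> v = 0" using c by simp
    then show False using v conjugate_square_eq_0_vec[of v n] by (simp add: conjugate_vec_def)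
  qed
  have p0: "poly (char_poly A) 0 = Determinant.det A"
  proof -
    have "poly (char_poly A) 0 = Determinant.det (- char_matrix A 0)"
      using char_poly_matrix[OF A] by simp
    also have "- char_matrix A 0 = transpose_mat A"
      using skew A unfolding skew_symmetric_mat_def char_matrix_def by auto
    finally show ?thesis using det_transpose[OF A] by simp
  qed
  have "lead_coeff (char_poly A) > 0" using degree_monic_char_poly[OF A] by auto
  from poly_pinfty_gt_lc[OF this] obtain b where
    b: "\<And>x. x \<ge> b \<Longrightarrow> poly (char_poly A) x \<ge> lead_coeff (char_poly A)" by auto
  define d where "d = max b 1"
  have "poly (char_poly A) d > 0"
    using b[of d] \<open>lead_coeff (char_poly A) > 0\<close> unfolding d_def by auto
  moreover have "d > 0" unfolding d_def by simp
  ultimately obtain x where "x > 0" "poly (char_poly A) x = 0"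
    using poly_IVT_pos[of 0 d "char_poly A"] p0 neg by auto
  then show False using noroot by blast
qed

lemma submatrix_principal_carrier:
  assumes A: "A \<in> carrier_mat n n" and S: "S \<subseteq> {..<n}"
  shows "submatrix A S S \<in> carrier_mat (card S) (card S)"
proof -
  have "{i. i < n \<and> i \<in> S} = S" using S by auto
  then show ?thesis using A by (intro carrier_matI) (auto simp: dim_submatrix)
qed

lemma skew_symmetric_submatrix:
  assumes A: "A \<in> carrier_mat n n" and skew: "skew_symmetric_mat A"
  shows "skew_symmetric_mat (submatrix A S S)"
proof -
  have A': "A $$ (j, i) = - A $$ (i, j)" if "i < n" "j < n" for i j
  proof -
    have "transpose_mat A $$ (i, j) = (- A) $$ (i, j)"
      using skew unfolding skew_symmetric_mat_def by simp
    then show ?thesis using that A by simp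
  qed
  have dims: "dim_row A = n" "dim_col A = n" using A by auto
  have pk: "pick S i < n" if "i < card {i. i < n \<and> i \<in> S}" for i
    using pick_le[of i n S] that by simp
  show ?thesis
    unfolding skew_symmetric_mat_def
    by (rule eq_matI) (auto simp: dim_submatrix submatrix_index dims intro!: A' pk)
qed

lemma principal_det_nonneg:
  assumes "A \<in> carrier_mat n n" "skew_symmetric_mat A" "S \<subseteq> {..<n}"
  shows "principal_det A S \<ge> 0"
  unfolding principal_det_def
  using skew_symmetric_det_nonneg submatrix_principal_carrier skew_symmetric_submatrix assms
  by blast

lemma principal_det_empty: "principal_det A {} = 1"
  unfolding principal_det_def
  by (rule det_dim_zero) (auto intro!: carrier_matI simp: dim_submatrix)

lemma principal_det_odd:
  assumes A: "A \<in> carrier_mat n n" "skew_symmetric_mat A" "S \<subseteq> {..<n}" and odd: "odd (card S)"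
  shows "principal_det A S = 0"
proof -
  let ?B = "submatrix A S S"
  have B: "?B \<in> carrier_mat (card S) (card S)" by (rule submatrix_principal_carrier[OF A(1,3)])
  have "transpose_mat ?B = - ?B"
    using skew_symmetric_submatrix[OF A(1,2)] unfolding skew_symmetric_mat_def .
  also have "- ?B = (-1) \<cdot>\<^sub>m ?B" by (rule eq_matI) auto
  finally have "Determinant.det ?B = (-1) ^ card S * Determinant.det ?B"
    using det_transpose[OF B] B by simp
  then show ?thesis using odd unfolding principal_det_def by simp
qed

lemma pmf_principal_det_pmf:
  assumes A: "A \<in> carrier_mat n n" and skew: "skew_symmetric_mat A"
  shows "pmf (principal_det_pmf A) S =
    (if S \<subseteq> {..<n} then principal_det A S / (\<Sum>T\<in>Pow {..<n}. principal_det A T) else 0)"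
proof -
  let ?Z = "\<Sum>T\<in>Pow {..<n}. principal_det A T"
  let ?f = "\<lambda>S. if S \<subseteq> {..<n} then principal_det A S / ?Z else 0"
  have dim: "dim_row A = n" using A by auto
  have nn: "principal_det A T \<ge> 0" if "T \<in> Pow {..<n}" for T
    using principal_det_nonneg[OF A skew] that by auto
  have "1 \<le> ?Z"
    using member_le_sum[of "{}" "Pow {..<n}" "principal_det A"] nn
    by (simp add: principal_det_empty)
  then have Z: "?Z > 0" by simp
  have f0: "0 \<le> ?f T" for T
    using nn Z by auto
  have "(\<integral>\<^sup>+T. ?f T \<partial>count_space UNIV) = (\<Sum>T\<in>Pow {..<n}. ennreal (?f T))"
    by (rule nn_integral_count_space') (auto simp: ennreal_eq_0_iff)
  also have "\<dots> = ennreal (\<Sum>T\<in>Pow {..<n}. ?f T)"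
    by (rule sum_ennreal) (rule f0)
  also have "(\<Sum>T\<in>Pow {..<n}. ?f T) = (\<Sum>T\<in>Pow {..<n}. principal_det A T / ?Z)"
    by (intro sum.cong) auto
  also have "\<dots> = 1" using Z by (simp flip: sum_divide_distrib)
  finally have "(\<integral>\<^sup>+T. ?f T \<partial>count_space UNIV) = 1" by simp
  from pmf_embed_pmf[of ?f, OF f0 this]
  show ?thesis unfolding principal_det_pmf_def dim .
qed

end

theory Submission
  imports Defs
begin

text \<open>
  Write \<open>V = [n] - {i}\<close>, let \<open>p\<close> be the vector of Pfaffians \<open>Pf A\<^sub>S\<close> of subsets \<open>S\<close> of \<open>V\<close>, and let
  \<open>q\<close> be the vector of the \<open>\<plusminus>Pf A\<close> on \<open>T \<union> {i}\<close>, \<open>T \<subseteq> V\<close>; the two conditional laws are \<open>p\<^sup>2\<close> and \<open>q\<^sup>2\<close>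
  after normalisation.  In the exterior algebra, \<open>p\<close> is the exponential of the 2-form \<open>A\<close> and
  \<open>q = a \<and> p\<close> with \<open>a\<close> the row of \<open>i\<close>.  Contracting the exponential with a vector \<open>u\<close> gives a wedge
  product again, so if \<open>u\<close> solves a linear system with matrix \<open>I + A\<close>, then \<open>q = \<Gamma> p\<close> for the Clifford
  multiplication \<open>\<Gamma>\<close> by \<open>u\<close>.  This \<open>\<Gamma>\<close> is symmetric, satisfies \<open>\<Gamma>\<^sup>2 = |u|\<^sup>2\<close>, and links only sets that
  differ in one element.  Hence \<open>p = \<Gamma> q / |u|\<^sup>2\<close>, and restricting \<open>q\<close> to the neighbours of a family \<open>F\<close>
  does not change \<open>\<Gamma> q\<close> on \<open>F\<close>; since \<open>\<Gamma>/|u|\<close> is an isometry, the mass of \<open>F\<close> is at most that of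
  its neighbours.  This is Hall's condition for the coupling.

  The same isometry shows by induction on \<open>n\<close> that \<open>\<Sum>\<^sub>S (Pf A\<^sub>S)\<^sup>2 = det (I + A)\<close>; scaling \<open>A\<close> and
  comparing constant terms in \<open>det (x I + A)\<close> yields \<open>det A = (Pf A)\<^sup>2\<close>.
\<close>

section \<open>Weighted Hall theorem\<close>

text \<open>Induction on \<open>card X + card Y\<close>. A point of weight zero can be deleted, and
  a proper nonempty \<open>F\<close> whose Hall inequality is an equality splits the problem into
  two smaller ones; otherwise mass is moved along one edge until such a case arises.\<close>

lemma weighted_hall:
  fixes p :: "'a \<Rightarrow> real" and q :: "'b \<Rightarrow> real"
  assumes "finite X" "finite Y"
    and "\<And>x. x \<in> X \<Longrightarrow> p x \<ge> 0" "\<And>y. y \<in> Y \<Longrightarrow> q y \<ge> 0"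
    and "sum p X = sum q Y"
    and "\<And>F. F \<subseteq> X \<Longrightarrow> sum p F \<le> sum q {y\<in>Y. \<exists>x\<in>F. R x y}"
  shows "\<exists>c. (\<forall>x y. c x y \<ge> 0) \<and> (\<forall>x y. c x y \<noteq> 0 \<longrightarrow> x \<in> X \<and> y \<in> Y \<and> R x y) \<and>
    (\<forall>x\<in>X. sum (c x) Y = p x) \<and> (\<forall>y\<in>Y. (\<Sum>x\<in>X. c x y) = q y)"
  using assms
proof (induction "card X + card Y" arbitrary: X Y p q rule: less_induct)
  case less
  define N where "N F = {y\<in>Y. \<exists>x\<in>F. R x y}" for F
  let ?coupling = "\<lambda>X Y p q c. (\<forall>x y. c x y \<ge> (0::real)) \<and>
    (\<forall>x y. c x y \<noteq> 0 \<longrightarrow> x \<in> X \<and> y \<in> Y \<and> R x y) \<and>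
    (\<forall>x\<in>X. sum (c x) Y = p x) \<and> (\<forall>y\<in>Y. (\<Sum>x\<in>X. c x y) = q y)"
  have fin: "finite X" "finite Y" by fact+
  have finN: "finite (N F)" for F using fin by (simp add: N_def)
  \<comment> \<open>Stated for all weights on the fixed \<open>X\<close> and \<open>Y\<close>,
    because it is applied below to weights reduced along an edge, where the index sets have not yet
    shrunk.\<close>
  have degenerate: "\<exists>c. ?coupling X Y p q c"
    if p0: "\<forall>x\<in>X. p x \<ge> 0" and q0: "\<forall>y\<in>Y. q y \<ge> 0" and tot: "sum p X = sum q Y"
      and hall: "\<forall>F\<subseteq>X. sum p F \<le> sum q (N F)" and deg: "(\<exists>x\<in>X. p x = 0) \<or> (\<exists>y\<in>Y. q y = 0) \<or>
      (\<exists>F. F \<subseteq> X \<and> F \<noteq> {} \<and> F \<noteq> X \<and> sum p F = sum q (N F))" for p q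
  proof -
    from deg consider x where "x \<in> X" "p x = 0" | y where "y \<in> Y" "q y = 0"
      | F where "F \<subseteq> X" "F \<noteq> {}" "F \<noteq> X" "sum p F = sum q (N F)" by blast
    then show ?thesis
    proof cases
      case 1
      have "card (X - {x}) < card X" using 1 fin by (meson card_Diff1_less)
      moreover have "sum p (X - {x}) = sum q Y" using 1 tot sum.remove[OF fin(1) 1(1), of p] by simp
      ultimately have "\<exists>c. ?coupling (X - {x}) Y p q c"
      proof (intro less.hyps)
        fix F assume "F \<subseteq> X - {x}"
        then have "F \<subseteq> X" by blast
        then show "sum p F \<le> sum q {y \<in> Y. \<exists>x\<in>F. R x y}" using hall unfolding N_def by blast
      qed (use fin p0 q0 in simp_all)
      then obtain c where c: "?coupling (X - {x}) Y p q c" ..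
      have "c x y = 0" for y using c by blast
      then have "sum (c x) Y = p x" and "(\<Sum>x\<in>X. c x y) = (\<Sum>x\<in>X - {x}. c x y)" for y
        using 1 sum.remove[OF fin(1) 1(1), of "\<lambda>x. c x y"] by simp_all
      with c have "?coupling X Y p q c" by (metis (no_types, lifting) DiffD1 DiffI singletonD)
      then show ?thesis by (intro exI)
    next
      case 2
      have "card (Y - {y}) < card Y" using 2 fin by (meson card_Diff1_less)
      moreover have "sum p X = sum q (Y - {y})" using 2 tot sum.remove[OF fin(2) 2(1), of q] by simp
      moreover have NF: "sum q (N F) = sum q {y' \<in> Y - {y}. \<exists>x\<in>F. R x y'}" for F
        using 2 fin by (intro sum.mono_neutral_right) (auto simp: N_def)
      ultimately have "\<exists>c. ?coupling X (Y - {y}) p q c"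
      proof (intro less.hyps)
        fix F assume "F \<subseteq> X"
        then show "sum p F \<le> sum q {y' \<in> Y - {y}. \<exists>x\<in>F. R x y'}"
          using hall NF by metis
      qed (use fin p0 q0 in simp_all)
      then obtain c where c: "?coupling X (Y - {y}) p q c" ..
      have "c x y = 0" for x using c by blast
      then have "(\<Sum>x\<in>X. c x y) = q y" and "sum (c x) Y = sum (c x) (Y - {y})" for x
        using 2 sum.remove[OF fin(2) 2(1), of "c x"] by simp_all
      with c have "?coupling X Y p q c" by (metis (no_types, lifting) DiffD1 DiffI singletonD)
      then show ?thesis by (intro exI)
    next
      case 3
      have F: "finite F" "X - F \<noteq> {}" "card F > 0" using 3 fin finite_subset by (auto simp: card_gt_0_iff)
      have NF: "N F \<subseteq> Y" by (auto simp: N_def)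
      have cards: "card F < card X" "card (X - F) < card X" "card (N F) \<le> card Y" "card (Y - N F) \<le> card Y"
        using 3 fin F NF by (auto intro!: psubset_card_mono card_mono)
      have "\<exists>c. ?coupling F (N F) p q c"
      proof (rule less.hyps)
        fix G assume "G \<subseteq> F"
        moreover from this have "{y \<in> N F. \<exists>x\<in>G. R x y} = N G" by (auto simp: N_def)
        ultimately show "sum p G \<le> sum q {y \<in> N F. \<exists>x\<in>G. R x y}"
          using hall 3(1) by (metis order_trans)
      next
        show "card F + card (N F) < card X + card Y" using cards by linarith
      qed (use p0 q0 3 F finN NF in blast)+
      then obtain c1 where c1: "?coupling F (N F) p q c1" ..
      have "\<exists>c. ?coupling (X - F) (Y - N F) p q c"
      proof (rule less.hyps)
        \<comment> \<open>Hall's condition for \<open>G \<union> F\<close>, minus the equality for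
          \<open>F\<close>, is Hall's condition for \<open>G\<close> once the neighbours of
          \<open>F\<close> are removed.\<close>
        fix G assume G: "G \<subseteq> X - F"
        have "sum p G + sum p F = sum p (G \<union> F)"
          using G F fin by (intro sum.union_disjoint[symmetric]) (auto intro: finite_subset)
        also have "\<dots> \<le> sum q (N (G \<union> F))"
        proof -
          have "G \<union> F \<subseteq> X" using G 3(1) by blast
          then show ?thesis using hall by blast
        qed
        also have "N (G \<union> F) = {y \<in> Y - N F. \<exists>x\<in>G. R x y} \<union> N F" by (auto simp: N_def)
        also have "sum q \<dots> = sum q {y \<in> Y - N F. \<exists>x\<in>G. R x y} + sum q (N F)"
          using fin(2) finN[of F] by (intro sum.union_disjoint) auto
        finally show "sum p G \<le> sum q {y \<in> Y - N F. \<exists>x\<in>G. R x y}" using 3(4) by linarith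
      next
        show "card (X - F) + card (Y - N F) < card X + card Y" using cards by linarith
      next
        show "sum p (X - F) = sum q (Y - N F)"
          using tot 3(1,4) fin NF by (simp add: sum_diff)
      qed (use p0 q0 fin in blast)+
      then obtain c2 where c2: "?coupling (X - F) (Y - N F) p q c2" ..
      have "?coupling X Y p q (\<lambda>x y. c1 x y + c2 x y)"
      proof (intro conjI allI ballI impI)
        fix x assume x: "x \<in> X"
        have "sum (c1 x) Y = sum (c1 x) (N F)" "sum (c2 x) Y = sum (c2 x) (Y - N F)"
          using c1 c2 NF fin by (auto intro!: sum.mono_neutral_right)
        moreover have "sum (c1 x) (N F) = 0" if "x \<notin> F" using c1 that by (intro sum.neutral) blast
        moreover have "sum (c2 x) (Y - N F) = 0" if "x \<in> F" using c2 that by (intro sum.neutral) blast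
        ultimately show "(\<Sum>y\<in>Y. c1 x y + c2 x y) = p x"
          using c1 c2 x by (cases "x \<in> F") (auto simp: sum.distrib)
      next
        fix y assume y: "y \<in> Y"
        have "(\<Sum>x\<in>X. c1 x y) = (\<Sum>x\<in>F. c1 x y)" "(\<Sum>x\<in>X. c2 x y) = (\<Sum>x\<in>X - F. c2 x y)"
          using c1 c2 3 fin by (auto intro!: sum.mono_neutral_right)
        moreover have "(\<Sum>x\<in>F. c1 x y) = 0" if "y \<notin> N F" using c1 that by (intro sum.neutral) blast
        moreover have "(\<Sum>x\<in>X - F. c2 x y) = 0" if "y \<in> N F" using c2 that by (intro sum.neutral) blast
        ultimately show "(\<Sum>x\<in>X. c1 x y + c2 x y) = q y"
          using c1 c2 y by (cases "y \<in> N F") (auto simp: sum.distrib)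
      next
        fix x y
        show "0 \<le> c1 x y + c2 x y" using c1 c2 by (simp add: add_nonneg_nonneg)
        assume "c1 x y + c2 x y \<noteq> 0"
        then have "c1 x y \<noteq> 0 \<or> c2 x y \<noteq> 0" by auto
        then show "x \<in> X" "y \<in> Y" "R x y" using c1 c2 3 NF by blast+
      qed
      then show ?thesis by (intro exI)
    qed
  qed
  have p0: "\<forall>x\<in>X. p x \<ge> 0" and q0: "\<forall>y\<in>Y. q y \<ge> 0" and tot: "sum p X = sum q Y"
    and hall: "\<forall>F\<subseteq>X. sum p F \<le> sum q (N F)"
    unfolding N_def using less.prems by blast+
  show ?case
  proof (cases "X = {}")
    case True
    then have "q y = 0" if "y \<in> Y" for y
      using that less.prems sum_nonneg_eq_0_iff[of Y q] by auto
    then have "?coupling X Y p q (\<lambda>x y. 0)" using True by auto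
    then show ?thesis by (intro exI)
  next
    case False
    show ?thesis
    proof (cases "\<exists>x\<in>X. p x = 0")
      case True
      then show ?thesis using degenerate[OF p0 q0 tot hall] by blast
    next
      case pos: False
      obtain x where x: "x \<in> X" using False by blast
      have px: "p x > 0" using pos x p0 by force
      have "sum p {x} \<le> sum q (N {x})" using hall x by blast
      then have "sum q (N {x}) \<noteq> 0" using px by auto
      then obtain y where "y \<in> N {x}" by (metis sum.neutral)
      then have y: "y \<in> Y" "R x y" by (auto simp: N_def)
      text \<open>Move as much mass along the edge \<open>(x, y)\<close> as Hall's condition allows.\<close>
      define slack where "slack F = sum q (N F) - sum p F" for F
      \<comment> \<open>Only sets that have \<open>y\<close> as a neighbour and omit
        \<open>x\<close> lose slack; a set containing \<open>x\<close> has \<open>y\<close> as a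
        neighbour, so both sides of its inequality drop equally.\<close>
      define E where "E = insert (p x) (insert (q y) (slack ` {F. F \<subseteq> X \<and> x \<notin> F \<and> y \<in> N F}))"
      define e where "e = Min E"
      have finE: "finite E" "E \<noteq> {}" using fin by (auto simp: E_def)
      have eE: "e \<in> E" unfolding e_def using finE by (rule Min_in)
      have le: "e \<le> z" if "z \<in> E" for z unfolding e_def using finE that by simp
      have e0: "e \<ge> 0" using eE p0 q0 hall x y by (auto simp: E_def slack_def)
      define p' where "p' = p(x := p x - e)"
      define q' where "q' = q(y := q y - e)"
      have p': "sum p' F = sum p F - (if x \<in> F then e else 0)" if "F \<subseteq> X" for F
        using finite_subset[OF that fin(1)] sum.remove[of F x p] sum.remove[of F x p']
        by (auto simp: p'_def intro: sum.cong)
      have q': "sum q' G = sum q G - (if y \<in> G then e else 0)" if "G \<subseteq> Y" for G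
        using finite_subset[OF that fin(2)] sum.remove[of G y q] sum.remove[of G y q']
        by (auto simp: q'_def intro: sum.cong)
      have NY: "N F \<subseteq> Y" for F by (auto simp: N_def)
      have hall': "sum p' F \<le> sum q' (N F)" if F: "F \<subseteq> X" for F
      proof -
        have 1: "y \<in> N F" if "x \<in> F" using that y by (auto simp: N_def)
        have 2: "e \<le> slack F" if "x \<notin> F" "y \<in> N F" using that F by (intro le) (auto simp: E_def)
        have "sum p F \<le> sum q (N F)" using hall F by blast
        then show ?thesis
          using 1 2 e0 unfolding p'[OF F] q'[OF NY] slack_def
          by auto
      qed
      have "e \<le> p x" "e \<le> q y" by (intro le; simp add: E_def)+
      then have "\<forall>x\<in>X. p' x \<ge> 0" "\<forall>y\<in>Y. q' y \<ge> 0"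
        using p0 q0 by (simp_all add: p'_def q'_def)
      moreover have "sum p' X = sum q' Y"
        using p'[of X] q'[of Y] x y tot by simp
      moreover have "(\<exists>x\<in>X. p' x = 0) \<or> (\<exists>y\<in>Y. q' y = 0) \<or>
        (\<exists>F. F \<subseteq> X \<and> F \<noteq> {} \<and> F \<noteq> X \<and> sum p' F = sum q' (N F))"
      proof -
        \<comment> \<open>The minimum is attained. If it is the slack of \<open>F\<close>, then
          \<open>F\<close> is nonempty because \<open>y\<close> is a neighbour, and proper because
          it omits \<open>x\<close>.\<close>
        consider "e = p x" | "e = q y" | F where "F \<subseteq> X" "x \<notin> F" "y \<in> N F" "e = slack F"
          using eE unfolding E_def by blast
        then show ?thesis
        proof cases
          case 1
          then have "p' x = 0" by (simp add: p'_def)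
          then show ?thesis using x by blast
        next
          case 2
          then have "q' y = 0" by (simp add: q'_def)
          then show ?thesis using y by blast
        next
          case 3
          then have "sum p' F = sum q' (N F)"
            using p'[of F] q'[OF NY, of F] by (simp add: slack_def)
          moreover have "F \<noteq> {}" using 3 by (auto simp: N_def)
          ultimately show ?thesis using 3 x by blast
        qed
      qed
      ultimately have "\<exists>c. ?coupling X Y p' q' c" using hall' by (intro degenerate) blast+
      then obtain c where c: "?coupling X Y p' q' c" ..
      define c' where "c' = (\<lambda>x' y'. c x' y' + (if x' = x \<and> y' = y then e else 0))"
      have "?coupling X Y p q c'"
      proof (intro conjI allI ballI impI)
        fix x' assume "x' \<in> X"
        then show "sum (c' x') Y = p x'"
          using c y fin by (cases "x' = x") (auto simp: c'_def sum.distrib p'_def)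
      next
        fix y' assume "y' \<in> Y"
        then show "(\<Sum>x'\<in>X. c' x' y') = q y'"
          using c x fin by (cases "y' = y") (auto simp: c'_def sum.distrib q'_def)
      next
        fix x' y'
        show "0 \<le> c' x' y'" using c e0 by (simp add: c'_def)
        assume "c' x' y' \<noteq> 0"
        then have "c x' y' \<noteq> 0 \<or> x' = x \<and> y' = y" by (auto simp: c'_def split: if_splits)
        then show "x' \<in> X" "y' \<in> Y" "R x' y'" using c x y by blast+
      qed
      then show ?thesis by (intro exI)
    qed
  qed
qed

section \<open>Pfaffians\<close>

definition flip :: "nat \<Rightarrow> nat set \<Rightarrow> nat set" where
  "flip k S = sym_diff S {k}"

text \<open>The sign of moving \<open>k\<close> past the larger elements of \<open>S\<close>. It
  ignores \<open>k\<close> itself, so one sign serves both for inserting and for removing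
  \<open>k\<close>.\<close>

definition koszul_sign :: "nat \<Rightarrow> nat set \<Rightarrow> real" where
  "koszul_sign k S = (-1) ^ card {x\<in>S. k < x}"

lemma flip_in: "k \<in> S \<Longrightarrow> flip k S = S - {k}"
  and flip_notin: "k \<notin> S \<Longrightarrow> flip k S = insert k S"
  by (auto simp: flip_def)

lemma flip_flip [simp]: "flip k (flip k S) = S"
  by (auto simp: flip_def)

lemma flip_commute: "flip k (flip l S) = flip l (flip k S)"
  by (auto simp: flip_def)

lemma finite_flip [simp]: "finite (flip k S) \<longleftrightarrow> finite S"
  by (auto simp: flip_def)

lemma flip_in_Pow: "k \<in> V \<Longrightarrow> flip k S \<in> Pow V \<longleftrightarrow> S \<in> Pow V"
  by (auto simp: flip_def)

lemma minus_one_card_flip: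
  assumes "finite S"
  shows "(-1) ^ card (flip k S) = - ((-1) ^ card S :: real)"
proof (cases "k \<in> S")
  case True
  then have "card S = Suc (card (flip k S))"
    using assms by (simp add: flip_in card_Suc_Diff1 del: card_Diff_insert)
  then show ?thesis by simp
next
  case False
  then show ?thesis using assms by (simp add: flip_notin)
qed

lemma koszul_sign_flip_self [simp]: "koszul_sign k (flip k S) = koszul_sign k S"
proof -
  have "{x \<in> flip k S. k < x} = {x \<in> S. k < x}" by (auto simp: flip_def)
  then show ?thesis by (simp add: koszul_sign_def)
qed

lemma koszul_sign_mult_self [simp]: "koszul_sign k S * koszul_sign k S = 1"
  by (simp add: koszul_sign_def flip: power_add)

lemma koszul_sign_flip:
  assumes "finite S" "k \<noteq> l"
  shows "koszul_sign k (flip l S) = (if k < l then - koszul_sign k S else koszul_sign k S)"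
proof -
  have "{x \<in> flip l S. k < x} = (if k < l then flip l {x \<in> S. k < x} else {x \<in> S. k < x})"
    using assms(2) by (auto simp: flip_def)
  then show ?thesis using assms by (simp add: koszul_sign_def minus_one_card_flip)
qed

text \<open>Toggling the larger index reverses the sign belonging to the smaller one, but not
  conversely. This discrepancy makes the Clifford generators anticommute.\<close>

lemma koszul_sign_anticommute:
  assumes "finite S" "k \<noteq> l"
  shows "koszul_sign k S * koszul_sign l (flip k S) = - (koszul_sign l S * koszul_sign k (flip l S))"
  using assms by (auto simp: koszul_sign_flip)

lemma koszul_sign_eq_1:
  assumes "\<And>x. x \<in> S \<Longrightarrow> x \<le> m"
  shows "koszul_sign m S = 1"
proof -
  have "{x \<in> S. m < x} = {}" using assms by force
  then show ?thesis unfolding koszul_sign_def by (simp only: card.empty power_0)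
qed

lemma koszul_sign_image:
  assumes f: "strict_mono_on T f" and k: "k \<in> T"
  shows "koszul_sign (f k) (f ` T) = koszul_sign k T"
proof -
  have "{x \<in> f ` T. f k < x} = f ` {x \<in> T. k < x}"
    using strict_mono_on_less[OF f] k by auto
  moreover have "inj_on f {x \<in> T. k < x}"
    using strict_mono_on_imp_inj_on[OF f] by (rule inj_on_subset) auto
  ultimately show ?thesis by (simp add: koszul_sign_def card_image)
qed

text \<open>
  The Pfaffian of the principal submatrix on \<open>S\<close>, expanded along its last row (infinite index
  sets get the junk value \<open>1\<close>).
\<close>

function pfaffian :: "(nat \<Rightarrow> nat \<Rightarrow> real) \<Rightarrow> nat set \<Rightarrow> real" where
  "pfaffian a S = (if finite S \<and> S \<noteq> {} then
     \<Sum>k\<in>S - {Max S}. a (Max S) k * koszul_sign k (S - {Max S}) * pfaffian a (S - {Max S} - {k}) else 1)"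
  by auto
termination
proof (relation "Wellfounded.measure (\<lambda>(a, S). card S)", goal_cases)
  case (2 a S k)
  then have "S - {Max S} - {k} \<subset> S" by auto
  then show ?case using 2 psubset_card_mono[of S "S - {Max S} - {k}"] by (simp del: card_Diff_insert)
qed simp

declare pfaffian.simps [simp del]

lemma pfaffian_empty [simp]: "pfaffian a {} = 1"
  by (simp add: pfaffian.simps)

lemma pfaffian_insert_max:
  assumes "finite R" "\<And>k. k \<in> R \<Longrightarrow> k < m"
  shows "pfaffian a (insert m R) = (\<Sum>k\<in>R. a m k * koszul_sign k R * pfaffian a (R - {k}))"
proof -
  have "Max (insert m R) = m"
    using assms by (intro Max_eqI) (auto simp: less_imp_le)
  moreover have "insert m R - {m} = R" using assms(2) by blast
  ultimately show ?thesis using assms by (simp add: pfaffian.simps[of a "insert m R"])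
qed

lemma finite_max_cases [consumes 1, case_names empty insert]:
  fixes S :: "nat set"
  assumes "finite S"
  obtains "S = {}" | m R where "S = insert m R" "finite R" "\<And>k. k \<in> R \<Longrightarrow> k < m"
proof (cases "S = {}")
  case False
  then have "S = insert (Max S) (S - {Max S})" using assms Max_in[of S] by blast
  moreover have "k < Max S" if "k \<in> S - {Max S}" for k
    using that assms by (simp add: order.not_eq_order_implies_strict)
  ultimately show ?thesis using that(2)[of "Max S" "S - {Max S}"] assms by auto
qed (use that in auto)

lemma sum_swap_off_diagonal:
  fixes h :: "'a \<Rightarrow> 'a \<Rightarrow> real"
  assumes "finite R"
  shows "(\<Sum>k\<in>R. \<Sum>l\<in>R - {k}. h k l) = (\<Sum>l\<in>R. \<Sum>k\<in>R - {l}. h k l)"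
proof -
  have *: "{y \<in> R. x \<noteq> y} = R - {x}" "{y \<in> R. y \<noteq> x} = R - {x}" for x by auto
  show ?thesis
    using sum.swap_restrict[OF assms assms, of h "\<lambda>k l. k \<noteq> l"] by (simp add: *)
qed

text \<open>Expansion along an arbitrary row; for \<open>j \<in> S\<close> it is that of a Pfaffian
  with a repeated row. The largest index \<open>m\<close> of \<open>S\<close> is split off, each
  smaller Pfaffian still containing \<open>m\<close> is expanded along it, and the double sum is
  reordered so that the induction hypothesis applies to the sets \<open>R - {l}\<close>.\<close>

lemma pfaffian_row_expansion:
  assumes skew: "\<And>k l. a k l = - a l k" and "finite S"
  shows "(\<Sum>k\<in>S. a j k * koszul_sign k S * pfaffian a (S - {k})) =
    (if j \<in> S then 0 else koszul_sign j S * pfaffian a (insert j S))"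
  using assms(2)
proof (induction S rule: finite_psubset_induct)
  case (psubset S)
  have diag: "a k k = 0" for k using skew[of k k] by linarith
  let ?F = "\<lambda>j S. \<Sum>k\<in>S. a j k * koszul_sign k S * pfaffian a (S - {k})"
  from psubset(1) show ?case
  proof (cases rule: finite_max_cases)
    case empty
    then show ?thesis using pfaffian_insert_max[of "{}" j a] by simp
  next
    case (insert m R)
    have m: "m \<notin> R" using insert by auto
    have S: "S = flip m R" "S - {m} = R" using insert m by (auto simp: flip_notin)
    have sgS: "koszul_sign k S = - koszul_sign k R" if "k \<in> R" for k
      using insert(3)[OF that] insert(2) unfolding S(1) by (subst koszul_sign_flip) auto
    have sgmS: "koszul_sign m S = 1" using insert by (intro koszul_sign_eq_1) (auto simp: less_imp_le)
    have swap: "koszul_sign k R * koszul_sign l (R - {k}) = - (koszul_sign l R * koszul_sign k (R - {l}))"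
      if "l \<in> R" "k \<in> R - {l}" for k l
      using koszul_sign_anticommute[OF insert(2), of k l] that by (auto simp: flip_in)
    have "?F j S = a j m * pfaffian a R + (\<Sum>k\<in>R. a j k * koszul_sign k S * pfaffian a (S - {k}))"
      using insert(2) m sgmS S(2) unfolding insert(1) by simp
    also have "(\<Sum>k\<in>R. a j k * koszul_sign k S * pfaffian a (S - {k})) =
        (\<Sum>k\<in>R. \<Sum>l\<in>R - {k}. - (a j k * a m l * (koszul_sign k R * koszul_sign l (R - {k})) * pfaffian a (R - {k} - {l})))"
    proof (rule sum.cong[OF refl])
      fix k assume k: "k \<in> R"
      have "S - {k} = insert m (R - {k})" using insert(1) k m by auto
      then have "pfaffian a (S - {k}) = (\<Sum>l\<in>R - {k}. a m l * koszul_sign l (R - {k}) * pfaffian a (R - {k} - {l}))"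
        using pfaffian_insert_max[of "R - {k}" m a] insert by simp
      then show "a j k * koszul_sign k S * pfaffian a (S - {k}) = (\<Sum>l\<in>R - {k}. - (a j k * a m l * (koszul_sign k R * koszul_sign l (R - {k})) * pfaffian a (R - {k} - {l})))"
        by (simp add: sgS[OF k] sum_distrib_left sum_negf ac_simps)
    qed
    finally have F: "?F j S = a j m * pfaffian a R + \<dots>" .
    also have "(\<Sum>k\<in>R. \<Sum>l\<in>R - {k}. - (a j k * a m l * (koszul_sign k R * koszul_sign l (R - {k})) * pfaffian a (R - {k} - {l}))) =
      (\<Sum>l\<in>R. \<Sum>k\<in>R - {l}. - (a j k * a m l * (koszul_sign k R * koszul_sign l (R - {k})) * pfaffian a (R - {k} - {l})))"
      by (rule sum_swap_off_diagonal[OF insert(2)])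
    also have "\<dots> = (\<Sum>l\<in>R. \<Sum>k\<in>R - {l}. a j k * a m l * (koszul_sign l R * koszul_sign k (R - {l})) * pfaffian a (R - {l} - {k}))"
    proof (intro sum.cong[OF refl])
      fix l k assume lk: "l \<in> R" "k \<in> R - {l}"
      have *: "R - {k} - {l} = R - {l} - {k}" by auto
      show "- (a j k * a m l * (koszul_sign k R * koszul_sign l (R - {k})) * pfaffian a (R - {k} - {l})) =
        a j k * a m l * (koszul_sign l R * koszul_sign k (R - {l})) * pfaffian a (R - {l} - {k})"
        using swap[OF lk] unfolding * by simp
    qed
    also have "\<dots> = (\<Sum>l\<in>R. a m l * koszul_sign l R * ?F j (R - {l}))"
      by (simp add: sum_distrib_left ac_simps)
    finally have F': "?F j S = a j m * pfaffian a R + (\<Sum>l\<in>R. a m l * koszul_sign l R * ?F j (R - {l}))" .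
    have IH: "?F j (R - {l}) = (if j \<in> R - {l} then 0 else koszul_sign j (R - {l}) * pfaffian a (insert j (R - {l})))"
      if "l \<in> R" for l
      using insert m that by (intro psubset.IH) auto
    consider "j = m" | "j \<in> R" | "j \<notin> R" "j < m" | "j > m" by fastforce
    then show ?thesis
    proof cases
      case 1
      \<comment> \<open>With \<open>j = m\<close>, the double sum before and after the reordering
        equals \<open>?D\<close> with opposite signs, so it vanishes.\<close>
      let ?D = "\<Sum>l\<in>R. a m l * koszul_sign l R * ?F m (R - {l})"
      have "?F m S = ?D" using F' diag[of m] 1 by simp
      moreover have "?F m S = - ?D"
      proof -
        have "(\<Sum>k\<in>R. \<Sum>l\<in>R - {k}. - (a m k * a m l * (koszul_sign k R * koszul_sign l (R - {k})) * pfaffian a (R - {k} - {l}))) = - ?D"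
          by (simp add: sum_distrib_left sum_negf ac_simps)
        then show ?thesis using F diag[of m] unfolding 1 by simp
      qed
      ultimately show ?thesis using 1 insert(1) by simp
    next
      case 2
      \<comment> \<open>For \<open>l \<noteq> j\<close> the index \<open>j\<close> still lies in
        \<open>R - {l}\<close>, so only \<open>l = j\<close> survives; its term cancels
        \<open>a j m * pfaffian a R\<close> by skew symmetry.\<close>
      have "(\<Sum>l\<in>R. a m l * koszul_sign l R * ?F j (R - {l})) =
        (\<Sum>l\<in>R. if l = j then a m l * koszul_sign l R * (koszul_sign j (R - {j}) * pfaffian a R) else 0)"
        using 2 by (intro sum.cong[OF refl]) (auto simp: IH insert_absorb)
      also have "\<dots> = a m j * (koszul_sign j R * koszul_sign j (flip j R)) * pfaffian a R"
        using 2 insert(2) by (simp add: flip_in)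
      finally show ?thesis using F' skew[of j m] 2 insert(1) by simp
    next
      case 3
      have sgS_j: "koszul_sign j S = - koszul_sign j R"
        using 3 insert(2) unfolding S(1) by (subst koszul_sign_flip) auto
      \<comment> \<open>Since \<open>j < m\<close>, the largest index of \<open>insert j S\<close>
        is still \<open>m\<close>, and the defining expansion runs over \<open>insert j R\<close>:
        the term \<open>l = j\<close> is the isolated one, the others match the induction
        hypothesis.\<close>
      have "pfaffian a (insert j S) = (\<Sum>l\<in>insert j R. a m l * koszul_sign l (insert j R) * pfaffian a (insert j R - {l}))"
        using pfaffian_insert_max[of "insert j R" m a] insert 3 by (auto simp: insert_commute)
      also have "\<dots> = a m j * koszul_sign j R * pfaffian a R + (\<Sum>l\<in>R. a m l * koszul_sign l (insert j R) * pfaffian a (insert j (R - {l})))"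
      proof -
        have "(\<Sum>l\<in>R. a m l * koszul_sign l (insert j R) * pfaffian a (insert j R - {l})) =
          (\<Sum>l\<in>R. a m l * koszul_sign l (insert j R) * pfaffian a (insert j (R - {l})))"
          using 3 by (intro sum.cong) (auto simp: insert_Diff_if)
        moreover have "insert j R - {j} = R" using 3 by auto
        moreover have "koszul_sign j (insert j R) = koszul_sign j R" using koszul_sign_flip_self[of j R] 3 by (simp add: flip_notin)
        ultimately show ?thesis using 3 insert(2) by simp
      qed
      finally have *: "koszul_sign j S * pfaffian a (insert j S) = - (koszul_sign j R * koszul_sign j R) * a m j * pfaffian a R
         - (\<Sum>l\<in>R. a m l * (koszul_sign j R * koszul_sign l (insert j R)) * pfaffian a (insert j (R - {l})))"
        using sgS_j by (simp add: algebra_simps sum_distrib_left sum_negf)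
      have "(\<Sum>l\<in>R. a m l * koszul_sign l R * ?F j (R - {l})) =
        - (\<Sum>l\<in>R. a m l * (koszul_sign j R * koszul_sign l (insert j R)) * pfaffian a (insert j (R - {l})))"
        unfolding sum_negf[symmetric]
      proof (intro sum.cong[OF refl])
        fix l assume l: "l \<in> R"
        then have "l \<noteq> j" using 3 by auto
        then have "koszul_sign l R * koszul_sign j (R - {l}) = - (koszul_sign j R * koszul_sign l (insert j R))"
          using koszul_sign_anticommute[OF insert(2), of l j] l 3 by (simp add: flip_in flip_notin)
        then show "a m l * koszul_sign l R * ?F j (R - {l}) =
          - (a m l * (koszul_sign j R * koszul_sign l (insert j R)) * pfaffian a (insert j (R - {l})))"
          unfolding IH[OF l] using 3 by (simp add: mult.assoc[symmetric]) (simp add: mult.assoc)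
      qed
      then show ?thesis using F' * skew[of j m] 3 insert(1) by simp
    next
      case 4
      \<comment> \<open>Here \<open>j\<close> exceeds all of \<open>S\<close>, and the claim is the
        defining expansion of the Pfaffian.\<close>
      have "k < j" if "k \<in> S" for k
        using that insert(1,3) 4 by (metis insertE order.strict_trans)
      then show ?thesis
        using pfaffian_insert_max[of S j a] psubset(1) koszul_sign_eq_1[of S j] by (auto simp: less_imp_le)
    qed
  qed
qed

section \<open>Clifford multiplication\<close>

text \<open>On coefficient vectors indexed by subsets, the terms with \<open>k \<in> S\<close> form
  the wedge product with \<open>u\<close>, those with \<open>k \<notin> S\<close> the contraction by
  \<open>u\<close>.\<close>

definition clifford :: "(nat \<Rightarrow> real) \<Rightarrow> nat set \<Rightarrow> (nat set \<Rightarrow> real) \<Rightarrow> nat set \<Rightarrow> real" where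
  "clifford u V f S = (\<Sum>k\<in>V. u k * koszul_sign k S * f (flip k S))"

text \<open>The terms for \<open>(k, l)\<close> and \<open>(l, k)\<close> with
  \<open>k \<noteq> l\<close> cancel by anticommutation; on the diagonal the flip is undone and the
  signs square to one.\<close>

lemma clifford_clifford:
  assumes "finite V" "finite S"
  shows "clifford u V (clifford u V f) S = (\<Sum>k\<in>V. (u k)\<^sup>2) * f S"
proof -
  define h where "h k l = u k * u l * (koszul_sign k S * koszul_sign l (flip k S)) * f (flip l (flip k S))" for k l
  have "clifford u V (clifford u V f) S = (\<Sum>k\<in>V. \<Sum>l\<in>V. h k l)"
    by (simp add: clifford_def h_def sum_distrib_left ac_simps)
  also have "\<dots> = (\<Sum>k\<in>V. h k k) + (\<Sum>k\<in>V. \<Sum>l\<in>V - {k}. h k l)"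
    unfolding sum.distrib[symmetric] by (intro sum.cong[OF refl] sum.remove[OF assms(1)])
  also have "(\<Sum>k\<in>V. \<Sum>l\<in>V - {k}. h k l) = 0"
  proof -
    have "(\<Sum>k\<in>V. \<Sum>l\<in>V - {k}. h k l) = (\<Sum>l\<in>V. \<Sum>k\<in>V - {l}. h k l)"
      by (rule sum_swap_off_diagonal[OF assms(1)])
    also have "\<dots> = (\<Sum>l\<in>V. \<Sum>k\<in>V - {l}. - h l k)"
    proof (intro sum.cong[OF refl])
      fix l k assume "l \<in> V" "k \<in> V - {l}"
      then have "koszul_sign k S * koszul_sign l (flip k S) = - (koszul_sign l S * koszul_sign k (flip l S))"
        by (intro koszul_sign_anticommute[OF assms(2)]) auto
      then show "h k l = - h l k" by (simp add: h_def flip_commute[of k l])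
    qed
    finally show ?thesis by (simp add: sum_negf)
  qed
  also have "(\<Sum>k\<in>V. h k k) = (\<Sum>k\<in>V. (u k)\<^sup>2) * f S"
    by (simp add: h_def sum_distrib_right power2_eq_square)
  finally show ?thesis by simp
qed

text \<open>Each \<open>flip k\<close> with \<open>k \<in> V\<close> is an involution of
  \<open>Pow V\<close> that preserves the sign, so reindexing moves it from \<open>f\<close> to
  \<open>g\<close>.\<close>

lemma clifford_symmetric:
  assumes "finite V"
  shows "(\<Sum>S\<in>Pow V. clifford u V f S * g S) = (\<Sum>S\<in>Pow V. f S * clifford u V g S)"
proof -
  have "(\<Sum>S\<in>Pow V. clifford u V f S * g S) = (\<Sum>k\<in>V. \<Sum>S\<in>Pow V. u k * koszul_sign k S * f (flip k S) * g S)"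
    unfolding clifford_def sum_distrib_right by (rule sum.swap)
  also have "\<dots> = (\<Sum>k\<in>V. \<Sum>S\<in>Pow V. f S * (u k * koszul_sign k S * g (flip k S)))"
  proof (rule sum.cong[OF refl])
    fix k assume "k \<in> V"
    then show "(\<Sum>S\<in>Pow V. u k * koszul_sign k S * f (flip k S) * g S) =
      (\<Sum>S\<in>Pow V. f S * (u k * koszul_sign k S * g (flip k S)))"
      by (intro sum.reindex_bij_witness[of _ "flip k" "flip k"]) (simp_all only: flip_in_Pow flip_flip koszul_sign_flip_self mult_ac)
  qed
  also have "\<dots> = (\<Sum>S\<in>Pow V. f S * clifford u V g S)"
    unfolding clifford_def sum_distrib_left by (rule sum.swap)
  finally show ?thesis .
qed

lemma clifford_norm:
  assumes "finite V"
  shows "(\<Sum>S\<in>Pow V. (clifford u V f S)\<^sup>2) = (\<Sum>k\<in>V. (u k)\<^sup>2) * (\<Sum>S\<in>Pow V. (f S)\<^sup>2)"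
proof -
  have "(\<Sum>S\<in>Pow V. (clifford u V f S)\<^sup>2) = (\<Sum>S\<in>Pow V. f S * clifford u V (clifford u V f) S)"
    unfolding power2_eq_square by (rule clifford_symmetric[OF assms])
  also have "\<dots> = (\<Sum>S\<in>Pow V. (\<Sum>k\<in>V. (u k)\<^sup>2) * (f S)\<^sup>2)"
  proof (rule sum.cong[OF refl])
    fix S assume "S \<in> Pow V"
    then have "finite S" using assms finite_subset by auto
    then show "f S * clifford u V (clifford u V f) S = (\<Sum>k\<in>V. (u k)\<^sup>2) * (f S)\<^sup>2"
      by (simp add: clifford_clifford[OF assms] power2_eq_square)
  qed
  finally show ?thesis by (simp add: sum_distrib_left)
qed

text \<open>
  Row expansion with weights \<open>u\<close> turns the contraction part of the Clifford operator into a
  wedge product, which the hypothesis on \<open>u\<close> combines with the wedge part.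
\<close>

lemma clifford_pfaffian:
  assumes skew: "\<And>k l. a k l = - a l k" and V: "finite V" "i \<notin> V" "T \<subseteq> V"
    and u: "\<And>k. k \<in> V \<Longrightarrow> a i k = u k + (\<Sum>j\<in>V. a j k * u j)"
  shows "koszul_sign i T * pfaffian a (insert i T) = clifford u V (pfaffian a) T"
proof -
  have T: "finite T" "i \<notin> T" using V finite_subset by auto
  have "koszul_sign i T * pfaffian a (insert i T) = (\<Sum>k\<in>T. a i k * koszul_sign k T * pfaffian a (T - {k}))"
    using pfaffian_row_expansion[where a = a and j = i, OF skew T(1)] T by simp
  also have "\<dots> = (\<Sum>k\<in>T. u k * koszul_sign k T * pfaffian a (T - {k}))
      + (\<Sum>k\<in>T. \<Sum>j\<in>V. u j * (a j k * koszul_sign k T * pfaffian a (T - {k})))"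
    unfolding sum.distrib[symmetric]
    using V by (intro sum.cong[OF refl]) (auto simp: u algebra_simps sum_distrib_left)
  also have "(\<Sum>k\<in>T. \<Sum>j\<in>V. u j * (a j k * koszul_sign k T * pfaffian a (T - {k}))) =
      (\<Sum>j\<in>V. u j * (\<Sum>k\<in>T. a j k * koszul_sign k T * pfaffian a (T - {k})))"
    by (subst sum.swap) (simp add: sum_distrib_left)
  \<comment> \<open>Row \<open>j\<close> of the expansion vanishes for \<open>j \<in> T\<close>;
    weighted by \<open>u j\<close>, what remains is the contraction of the Pfaffian vector by
    \<open>u\<close>.\<close>
  also have "\<dots> = (\<Sum>j\<in>V. u j * (if j \<in> T then 0 else koszul_sign j T * pfaffian a (insert j T)))"
    by (simp only: pfaffian_row_expansion[where a = a, OF skew T(1)])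
  also have "(\<Sum>k\<in>T. u k * koszul_sign k T * pfaffian a (T - {k})) = (\<Sum>k\<in>V. if k \<in> T then u k * koszul_sign k T * pfaffian a (T - {k}) else 0)"
    using V by (simp add: sum.If_cases inf_absorb2)
  finally have "koszul_sign i T * pfaffian a (insert i T) = (\<Sum>k\<in>V. (if k \<in> T then u k * koszul_sign k T * pfaffian a (T - {k}) else 0)
      + u k * (if k \<in> T then 0 else koszul_sign k T * pfaffian a (insert k T)))"
    by (simp only: sum.distrib)
  also have "\<dots> = clifford u V (pfaffian a) T"
    unfolding clifford_def by (intro sum.cong[OF refl]) (simp add: flip_in flip_notin)
  finally show ?thesis .
qed

section \<open>Principal minors as squares of Pfaffians\<close>

text \<open>The recursion uses only the entries and the order of the indices, so an increasing
  relabelling changes nothing. This reduces arbitrary index sets to initial segments.\<close>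

lemma pfaffian_image:
  assumes "finite T" "strict_mono_on T f"
  shows "pfaffian a (f ` T) = pfaffian (\<lambda>i j. a (f i) (f j)) T"
  using assms
proof (induction T rule: finite_psubset_induct)
  case (psubset T)
  from psubset(1) show ?case
  proof (cases rule: finite_max_cases)
    case (insert m R)
    have f: "strict_mono_on R f"
      using psubset.prems insert(1) by (auto simp: strict_mono_on_def)
    have lt: "f k < f m" if "k \<in> R" for k
      using psubset.prems insert(1) insert(3)[OF that] that by (auto simp: strict_mono_on_def)
    have inj: "inj_on f R" by (rule strict_mono_on_imp_inj_on[OF f])
    have "pfaffian a (f ` T) = (\<Sum>k\<in>f ` R. a (f m) k * koszul_sign k (f ` R) * pfaffian a (f ` R - {k}))"
      using pfaffian_insert_max[of "f ` R" "f m" a] lt insert(1,2) by auto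
    also have "\<dots> = (\<Sum>k\<in>R. a (f m) (f k) * koszul_sign (f k) (f ` R) * pfaffian a (f ` R - {f k}))"
      by (simp add: sum.reindex[OF inj])
    also have "\<dots> = (\<Sum>k\<in>R. a (f m) (f k) * koszul_sign k R * pfaffian (\<lambda>i j. a (f i) (f j)) (R - {k}))"
    proof (rule sum.cong[OF refl])
      fix k assume k: "k \<in> R"
      have "f ` R - {f k} = f ` (R - {k})" using inj k by (auto simp: inj_on_def)
      moreover have "R - {k} \<subset> T" using insert by auto
      moreover have "strict_mono_on (R - {k}) f" using f by (auto simp: strict_mono_on_def)
      ultimately show "a (f m) (f k) * koszul_sign (f k) (f ` R) * pfaffian a (f ` R - {f k}) =
          a (f m) (f k) * koszul_sign k R * pfaffian (\<lambda>i j. a (f i) (f j)) (R - {k})"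
        by (simp add: koszul_sign_image[OF f k] psubset.IH)
    qed
    finally show ?thesis using insert by (simp add: pfaffian_insert_max)
  qed simp
qed

text \<open>Every expansion step removes two indices and extracts one entry. Writing the factor as a
  square avoids halving \<open>card S\<close>.\<close>

lemma pfaffian_scale:
  assumes "finite S"
  shows "pfaffian (\<lambda>i j. c\<^sup>2 * a i j) S = c ^ card S * pfaffian a S"
  using assms
proof (induction S rule: finite_psubset_induct)
  case (psubset S)
  from psubset(1) show ?case
  proof (cases rule: finite_max_cases)
    case (insert m R)
    have "pfaffian (\<lambda>i j. c\<^sup>2 * a i j) S = (\<Sum>k\<in>R. c\<^sup>2 * a m k * koszul_sign k R * pfaffian (\<lambda>i j. c\<^sup>2 * a i j) (R - {k}))"
      using insert by (simp add: pfaffian_insert_max)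
    also have "\<dots> = (\<Sum>k\<in>R. c ^ card S * (a m k * koszul_sign k R * pfaffian a (R - {k})))"
    proof (rule sum.cong[OF refl])
      fix k assume k: "k \<in> R"
      have "m \<notin> R" using insert(3) by blast
      then have "card S = Suc (Suc (card (R - {k})))"
        using insert(1,2) k card_Suc_Diff1[OF insert(2) k] by (simp del: card_Diff_insert)
      moreover have "pfaffian (\<lambda>i j. c\<^sup>2 * a i j) (R - {k}) = c ^ card (R - {k}) * pfaffian a (R - {k})"
        using insert by (intro psubset.IH) auto
      ultimately show "c\<^sup>2 * a m k * koszul_sign k R * pfaffian (\<lambda>i j. c\<^sup>2 * a i j) (R - {k}) =
          c ^ card S * (a m k * koszul_sign k R * pfaffian a (R - {k}))"
        by (simp only: power_Suc power2_eq_square[of c] mult_ac)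
    qed
    finally show ?thesis using insert by (simp add: pfaffian_insert_max sum_distrib_left)
  qed simp
qed

text \<open>
  The matrix \<open>x I + A\<^sup>T\<close>, transposed to match the linear system in \<open>clifford_pfaffian\<close>.
\<close>

definition shift_mat :: "(nat \<Rightarrow> nat \<Rightarrow> real) \<Rightarrow> nat \<Rightarrow> real \<Rightarrow> real mat" where
  "shift_mat a m x = mat m m (\<lambda>(i, j). (if i = j then x else 0) + a j i)"

lemma shift_mat_carrier [simp]: "shift_mat a m x \<in> carrier_mat m m"
  by (simp add: shift_mat_def)

section \<open>The linear system for \<open>u\<close>, and the effect of one more row and column on
  the determinant\<close>

lemma shift_mat_solvable:
  assumes "Determinant.det (shift_mat a m 1) \<noteq> 0"
  obtains u where "\<And>k. k < m \<Longrightarrow> b k = u k + (\<Sum>j<m. a j k * u j)"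
proof -
  let ?M = "shift_mat a m 1" and ?b = "vec m b"
  \<comment> \<open>Cramer's rule: the adjugate divided by the determinant is the inverse.\<close>
  define v where "v = (1 / Determinant.det ?M) \<cdot>\<^sub>v (adj_mat ?M *\<^sub>v ?b)"
  have adj: "adj_mat ?M \<in> carrier_mat m m" by (rule adj_mat(1)) simp
  have v: "v \<in> carrier_vec m"
    unfolding v_def using adj by (simp add: mult_mat_vec_carrier)
  have "?M *\<^sub>v v = (1 / Determinant.det ?M) \<cdot>\<^sub>v ((?M * adj_mat ?M) *\<^sub>v ?b)"
    unfolding v_def using adj by (simp add: mult_mat_vec[OF shift_mat_carrier] mult_mat_vec_carrier assoc_mult_mat_vec[of _ m m _ m])
  also have "\<dots> = ?b"
    unfolding adj_mat(2)[OF shift_mat_carrier] using assms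
    by (intro eq_vecI) (auto simp: scalar_prod_def if_distrib if_distribR cong: if_cong)
  finally have Mv: "?M *\<^sub>v v = ?b" .
  show ?thesis
  proof
    fix k assume k: "k < m"
    have "b k = (?M *\<^sub>v v) $ k" using Mv k by simp
    also have "\<dots> = (\<Sum>j<m. (if k = j then v $ j else 0) + a j k * v $ j)"
      using k v by (auto simp: shift_mat_def scalar_prod_def lessThan_atLeast0 distrib_right intro!: sum.cong)
    finally show "b k = v $ k + (\<Sum>j<m. a j k * v $ j)" using k by (simp add: sum.distrib)
  qed
qed

text \<open>Adding to the last column the other columns with coefficients \<open>- u k\<close>
  clears it above the corner, which becomes \<open>1 + |u|^2\<close>.\<close>

lemma det_shift_mat_Suc:
  assumes skew: "\<And>k l. a k l = - a l k"
    and u: "\<And>k. k < m \<Longrightarrow> a m k = u k + (\<Sum>j<m. a j k * u j)"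
  shows "Determinant.det (shift_mat a (Suc m) 1) = (1 + (\<Sum>k<m. (u k)\<^sup>2)) * Determinant.det (shift_mat a m 1)"
proof -
  let ?M = "shift_mat a m 1"
  define c where "c = mat m 1 (\<lambda>(i, j). a m i)"
  define r where "r = mat 1 m (\<lambda>(i, j). a j m)"
  define w where "w = mat m 1 (\<lambda>(i, j). - u i)"
  define U where "U = four_block_mat (1\<^sub>m m) w (0\<^sub>m 1 m) (1\<^sub>m 1)"
  have carr: "c \<in> carrier_mat m 1" "r \<in> carrier_mat 1 m" "w \<in> carrier_mat m 1"
    by (simp_all add: c_def r_def w_def)
  have diag: "a m m = 0" using skew[of m m] by linarith
  have M: "shift_mat a (Suc m) 1 = four_block_mat ?M c r (1\<^sub>m 1)"
    by (rule eq_matI) (auto simp: shift_mat_def c_def r_def diag less_Suc_eq)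
  have Mw: "?M * w + c = 0\<^sub>m m 1"
  proof (rule eq_matI)
    fix i j assume ij: "i < dim_row (0\<^sub>m m 1)" "j < dim_col (0\<^sub>m m 1)"
    have "(?M * w) $$ (i, j) = (\<Sum>j<m. (if i = j then - u j else 0) - a j i * u j)"
      using ij by (auto simp: shift_mat_def w_def scalar_prod_def lessThan_atLeast0 algebra_simps intro!: sum.cong)
    also have "\<dots> = - a m i" using ij u[of i] by (simp add: sum_subtractf)
    finally show "(?M * w + c) $$ (i, j) = 0\<^sub>m m 1 $$ (i, j)" using ij by (simp add: w_def c_def)
  qed (simp_all add: c_def)
  have rw: "(r * w + 1\<^sub>m 1) $$ (0, 0) = 1 + (\<Sum>k<m. (u k)\<^sup>2)"
  proof -
    have "(r * w) $$ (0, 0) = (\<Sum>j<m. - (a j m * u j))"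
      by (simp add: r_def w_def scalar_prod_def lessThan_atLeast0)
    also have "\<dots> = (\<Sum>j<m. a m j * u j)"
      using skew by (intro sum.cong[OF refl]) (metis minus_mult_left)
    \<comment> \<open>Substituting the system for \<open>a m j\<close> leaves \<open>|u|^2\<close>
      and the quadratic form of a skew matrix, which is zero.\<close>
    also have "\<dots> = (\<Sum>j<m. (u j)\<^sup>2) + (\<Sum>j<m. \<Sum>k<m. a k j * u k * u j)"
      by (simp add: u distrib_right sum.distrib power2_eq_square sum_distrib_right)
    also have "(\<Sum>j<m. \<Sum>k<m. a k j * u k * u j) = 0"
    proof -
      have "(\<Sum>j<m. \<Sum>k<m. a k j * u k * u j) = (\<Sum>k<m. \<Sum>j<m. a k j * u k * u j)"
        by (rule sum.swap)
      also have "\<dots> = (\<Sum>k<m. \<Sum>j<m. - (a j k * u j * u k))"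
      proof (intro sum.cong[OF refl])
        fix k j
        show "a k j * u k * u j = - (a j k * u j * u k)" unfolding skew[of k j] by simp
      qed
      finally show ?thesis by (simp add: sum_negf)
    qed
    finally show ?thesis using carr by simp
  qed
  have detU: "Determinant.det U = 1"
    unfolding U_def using carr by (subst det_four_block_mat_lower_left_zero[of _ m _ 1]) auto
  have U: "U \<in> carrier_mat (Suc m) (Suc m)"
    unfolding U_def using four_block_carrier_mat[of "1\<^sub>m m" m m "1\<^sub>m 1" 1 1] by simp
  have "shift_mat a (Suc m) 1 * U = four_block_mat (?M * 1\<^sub>m m + c * 0\<^sub>m 1 m) (?M * w + c * 1\<^sub>m 1)
      (r * 1\<^sub>m m + 1\<^sub>m 1 * 0\<^sub>m 1 m) (r * w + 1\<^sub>m 1 * 1\<^sub>m 1)"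
    unfolding M U_def using carr by (intro mult_four_block_mat) auto
  also have "\<dots> = four_block_mat ?M (0\<^sub>m m 1) r (r * w + 1\<^sub>m 1)"
    using carr Mw right_mult_one_mat[OF shift_mat_carrier] right_add_zero_mat[OF shift_mat_carrier]
    by simp
  finally have "Determinant.det (shift_mat a (Suc m) 1) * Determinant.det U =
      Determinant.det (four_block_mat ?M (0\<^sub>m m 1) r (r * w + 1\<^sub>m 1))"
    using det_mult[OF shift_mat_carrier U, of a 1] by metis
  also have "\<dots> = Determinant.det ?M * Determinant.det (r * w + 1\<^sub>m 1)"
    using carr by (intro det_four_block_mat_upper_right_zero) auto
  also have "Determinant.det (r * w + 1\<^sub>m 1) = 1 + (\<Sum>k<m. (u k)\<^sup>2)"
    using rw carr by (subst det_single) auto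
  finally show ?thesis using detU by simp
qed

section \<open>The sum of all squared Pfaffians, and from it each single principal minor\<close>

lemma sum_Pow_insert:
  assumes "finite V" "i \<notin> V"
  shows "(\<Sum>S\<in>Pow (insert i V). h S) = (\<Sum>S\<in>Pow V. h S) + (\<Sum>S\<in>Pow V. h (insert i S) :: real)"
proof -
  have "inj_on (insert i) (Pow V)" "Pow V \<inter> insert i ` Pow V = {}"
    using assms(2) by (auto simp: inj_on_def)
  then show ?thesis
    using assms(1) by (simp add: Pow_insert sum.union_disjoint sum.reindex)
qed

text \<open>The empty set contributes 1. Through \<open>sum_pfaffian_power2\<close> this makes
  \<open>shift_mat a m 1\<close> invertible for skew \<open>a\<close>, so the systems for
  \<open>u\<close> are solvable.\<close>

lemma sum_pfaffian_power2_pos: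
  assumes "finite V"
  shows "0 < (\<Sum>S\<in>Pow V. (pfaffian a S)\<^sup>2)"
  using assms by (intro sum_pos2[where i = "{}"]) auto

text \<open>Passing from \<open>m\<close> to \<open>Suc m\<close> multiplies both sides by
  \<open>1 + |u|^2\<close>: up to signs, the Pfaffians of the sets containing \<open>m\<close> form
  a Clifford image of the others. The induction hypothesis itself supplies the nonzero determinant
  needed to find \<open>u\<close>.\<close>

lemma sum_pfaffian_power2:
  assumes skew: "\<And>k l. a k l = - a l k"
  shows "(\<Sum>S\<in>Pow {..<m}. (pfaffian a S)\<^sup>2) = Determinant.det (shift_mat a m 1)"
proof (induction m)
  case 0
  have "Determinant.det (shift_mat a 0 1) = 1" by (rule det_dim_zero) simp
  then show ?case by simp
next
  case (Suc m)
  have "Determinant.det (shift_mat a m 1) \<noteq> 0"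
    using Suc sum_pfaffian_power2_pos[of "{..<m}" a] by simp
  then obtain u where u: "\<And>k. k < m \<Longrightarrow> a m k = u k + (\<Sum>j<m. a j k * u j)"
    using shift_mat_solvable[of a m "a m"] by blast
  have "(\<Sum>T\<in>Pow {..<m}. (pfaffian a (insert m T))\<^sup>2) = (\<Sum>T\<in>Pow {..<m}. (clifford u {..<m} (pfaffian a) T)\<^sup>2)"
  proof (rule sum.cong[OF refl])
    fix T assume "T \<in> Pow {..<m}"
    then have "clifford u {..<m} (pfaffian a) T = koszul_sign m T * pfaffian a (insert m T)"
      using u by (intro clifford_pfaffian[where a = a, OF skew, symmetric]) auto
    then show "(pfaffian a (insert m T))\<^sup>2 = (clifford u {..<m} (pfaffian a) T)\<^sup>2"
      by (simp add: power_mult_distrib power2_eq_square[of "koszul_sign m T"])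
  qed
  also have "\<dots> = (\<Sum>k<m. (u k)\<^sup>2) * (\<Sum>S\<in>Pow {..<m}. (pfaffian a S)\<^sup>2)"
    by (rule clifford_norm) simp
  finally show ?case
    using det_shift_mat_Suc[where a = a and u = u, OF skew u] Suc
    by (simp add: lessThan_Suc sum_Pow_insert distrib_right)
qed

lemma det_eq_pfaffian_power2:
  assumes skew: "\<And>k l. a k l = - a l k"
  shows "Determinant.det (mat m m (\<lambda>(i, j). a i j)) = (pfaffian a {..<m})\<^sup>2"
proof -
  \<comment> \<open>Chosen so that the characteristic polynomial of \<open>B\<close> is
    \<open>det (x I + A^T)\<close>.\<close>
  define B where "B = mat m m (\<lambda>(i, j). - a j i)"
  have B: "B \<in> carrier_mat m m" by (simp add: B_def)
  have charB: "poly (char_poly B) x = Determinant.det (shift_mat a m x)" for x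
  proof -
    have "- char_matrix B x = shift_mat a m x"
      by (rule eq_matI) (auto simp: B_def char_matrix_def shift_mat_def)
    then show ?thesis using char_poly_matrix[OF B] by simp
  qed
  define P where "P = (\<Sum>S\<in>Pow {..<m}. monom ((pfaffian a S)\<^sup>2) (m - card S))"
  \<comment> \<open>Rescaling the entries by \<open>1 / x\<close>, the square of
    \<open>1 / y\<close>, needs \<open>x > 0\<close>; infinitely many such \<open>x\<close> already
    identify the two polynomials.\<close>
  have "poly (char_poly B) x = poly P x" if "x > 0" for x
  proof -
    define y where "y = sqrt x"
    have y: "y > 0" "x = y\<^sup>2" using that by (simp_all add: y_def)
    let ?a = "\<lambda>i j. (1 / y)\<^sup>2 * a i j"
    have "shift_mat a m x = x \<cdot>\<^sub>m shift_mat ?a m 1"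
      using y by (intro eq_matI) (auto simp: shift_mat_def distrib_left power_divide)
    then have "Determinant.det (shift_mat a m x) = x ^ m * Determinant.det (shift_mat ?a m 1)"
      by (simp add: det_smult) (simp add: shift_mat_def)
    also have "Determinant.det (shift_mat ?a m 1) = (\<Sum>S\<in>Pow {..<m}. (pfaffian ?a S)\<^sup>2)"
    proof (rule sum_pfaffian_power2[symmetric])
      show "?a k l = - ?a l k" for k l unfolding skew[of k l] by simp
    qed
    also have "x ^ m * \<dots> = (\<Sum>S\<in>Pow {..<m}. (pfaffian a S)\<^sup>2 * x ^ (m - card S))"
      unfolding sum_distrib_left
    proof (rule sum.cong[OF refl])
      fix S assume S: "S \<in> Pow {..<m}"
      then have "finite S" "card S \<le> m"
        using finite_subset[of S "{..<m}"] card_mono[of "{..<m}" S] by auto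
      then have "x ^ m = x ^ (m - card S) * x ^ card S" by (simp flip: power_add)
      moreover have "(pfaffian ?a S)\<^sup>2 = (1 / x) ^ card S * (pfaffian a S)\<^sup>2"
      proof -
        have "pfaffian ?a S = (1 / y) ^ card S * pfaffian a S" using \<open>finite S\<close> by (rule pfaffian_scale)
        moreover have "((1 / y) ^ card S)\<^sup>2 = (1 / x) ^ card S"
          unfolding y(2) by (simp add: power_one_over power_commutes flip: power_mult) (simp add: mult.commute)
        ultimately show ?thesis by (simp only: power_mult_distrib)
      qed
      ultimately show "x ^ m * (pfaffian ?a S)\<^sup>2 = (pfaffian a S)\<^sup>2 * x ^ (m - card S)"
        using that by (simp add: power_divide)
    qed
    finally show ?thesis by (simp add: charB P_def poly_sum poly_monom)
  qed
  then have "{0<..} \<subseteq> {x. poly (char_poly B - P) x = 0}" by auto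
  then have "infinite {x. poly (char_poly B - P) x = 0}"
    using infinite_Ioi finite_subset by blast
  then have "char_poly B = P" using poly_roots_finite[of "char_poly B - P"] by auto
  then have "Determinant.det (shift_mat a m 0) = poly P 0" using charB[of 0] by simp
  \<comment> \<open>At zero only the exponent \<open>m - card S = 0\<close> survives, which belongs
    to the full index set.\<close>
  also have "\<dots> = (\<Sum>S\<in>Pow {..<m}. if S = {..<m} then (pfaffian a S)\<^sup>2 else 0)"
    unfolding P_def poly_sum
  proof (rule sum.cong[OF refl])
    fix S assume "S \<in> Pow {..<m}"
    then have "S \<noteq> {..<m} \<longrightarrow> card S < m"
      using psubset_card_mono[of "{..<m}" S] by (auto simp: psubset_eq)
    then show "poly (monom ((pfaffian a S)\<^sup>2) (m - card S)) 0 = (if S = {..<m} then (pfaffian a S)\<^sup>2 else 0)"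
      by (auto simp: poly_monom power_0_left)
  qed
  also have "\<dots> = (pfaffian a {..<m})\<^sup>2" by simp
  also have "shift_mat a m 0 = transpose_mat (mat m m (\<lambda>(i, j). a i j))"
    by (rule eq_matI) (auto simp: shift_mat_def)
  finally show ?thesis using det_transpose[of "mat m m (\<lambda>(i, j). a i j)" m] by simp
qed

lemma principal_det_eq_pfaffian_power2:
  assumes A: "A \<in> carrier_mat n n" and S: "S \<subseteq> {..<n}"
    and skew: "\<And>k l. a k l = - a l k"
    and a: "\<And>k l. k < n \<Longrightarrow> l < n \<Longrightarrow> a k l = A $$ (k, l)"
  shows "principal_det A S = (pfaffian a S)\<^sup>2"
proof -
  let ?k = "card S" and ?b = "\<lambda>i j. a (pick S i) (pick S j)"
  have fin: "finite S" using S finite_subset by blast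
  have pick: "pick S i \<in> S" if "i < ?k" for i using that by (rule pick_in_set_le)
  \<comment> \<open>\<open>pick S\<close> enumerates \<open>S\<close> increasingly, as the
    relabelling lemma \<open>pfaffian_image\<close> requires.\<close>
  have mono: "strict_mono_on {..<?k} (pick S)"
    by (auto simp: strict_mono_on_def intro: pick_mono_le)
  have img: "pick S ` {..<?k} = S"
    using pick card_image[OF strict_mono_on_imp_inj_on[OF mono]]
    by (intro card_subset_eq[OF fin]) auto
  have "{i. i < n \<and> i \<in> S} = S" using S by auto
  then have "submatrix A S S = mat ?k ?k (\<lambda>(i, j). ?b i j)"
    using A S pick unfolding submatrix_def by (intro eq_matI) (auto intro!: a[symmetric])
  then have "principal_det A S = (pfaffian ?b {..<?k})\<^sup>2"
    unfolding principal_det_def by (simp only: det_eq_pfaffian_power2[of ?b, OF skew])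
  also have "pfaffian ?b {..<?k} = pfaffian a S"
    using pfaffian_image[OF _ mono, of a] img by simp
  finally show ?thesis .
qed

section \<open>The coupling\<close>

lemma clifford_hall:
  assumes V: "finite V" and F: "F \<subseteq> Pow V"
  defines "N \<equiv> {T \<in> Pow V. \<exists>S\<in>F. \<exists>k\<in>V. T = flip k S}"
  shows "(\<Sum>k\<in>V. (u k)\<^sup>2) * (\<Sum>S\<in>F. (f S)\<^sup>2) \<le> (\<Sum>T\<in>N. (clifford u V f T)\<^sup>2)"
proof -
  define s where "s = (\<Sum>k\<in>V. (u k)\<^sup>2)"
  \<comment> \<open>The truncated image keeps its values at all neighbours of \<open>F\<close>, so a
    second application still returns \<open>s * f S\<close> on \<open>F\<close>, and the norm
    identity for \<open>h\<close> bounds the mass of \<open>F\<close>.\<close>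
  define h where "h T = (if T \<in> N then clifford u V f T else 0)" for T
  have N: "N \<subseteq> Pow V" by (auto simp: N_def)
  have h: "clifford u V h S = s * f S" if "S \<in> F" for S
  proof -
    have "clifford u V h S = clifford u V (clifford u V f) S"
      unfolding clifford_def[of u V h] clifford_def[of u V "clifford u V f"]
    proof (rule sum.cong[OF refl])
      fix k assume k: "k \<in> V"
      then have "flip k S \<in> Pow V" using that F by (auto simp only: flip_in_Pow)
      then have "flip k S \<in> N" using that k unfolding N_def by blast
      then show "u k * koszul_sign k S * h (flip k S) = u k * koszul_sign k S * clifford u V f (flip k S)"
        by (simp add: h_def)
    qed
    also have "\<dots> = s * f S"
      unfolding s_def using that F V by (intro clifford_clifford) (auto intro: finite_subset)
    finally show ?thesis .
  qed
  have "s * (s * (\<Sum>S\<in>F. (f S)\<^sup>2)) = (\<Sum>S\<in>F. (clifford u V h S)\<^sup>2)"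
    by (simp add: h sum_distrib_left power2_eq_square ac_simps)
  also have "\<dots> \<le> (\<Sum>S\<in>Pow V. (clifford u V h S)\<^sup>2)"
    using V F by (intro sum_mono2) auto
  also have "\<dots> = s * (\<Sum>S\<in>Pow V. (h S)\<^sup>2)"
    unfolding s_def by (rule clifford_norm[OF V])
  also have "(\<Sum>S\<in>Pow V. (h S)\<^sup>2) = (\<Sum>S\<in>N. (h S)\<^sup>2)"
    using V N by (intro sum.mono_neutral_right) (auto simp: h_def)
  also have "\<dots> = (\<Sum>T\<in>N. (clifford u V f T)\<^sup>2)"
    by (simp add: h_def)
  finally have "s * (s * (\<Sum>S\<in>F. (f S)\<^sup>2)) \<le> s * (\<Sum>T\<in>N. (clifford u V f T)\<^sup>2)" .
  moreover have "s \<ge> 0" by (simp add: s_def sum_nonneg)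
  \<comment> \<open>For \<open>s = 0\<close> the left side is zero; otherwise one factor
    \<open>s\<close> cancels.\<close>
  ultimately show ?thesis
    unfolding s_def[symmetric] by (cases "s = 0") (auto simp: sum_nonneg)
qed

text \<open>\<open>X\<close> and \<open>Y\<close> need only contain the supports, so whole power
  sets can be used. The matrix from \<open>weighted_hall\<close> serves as the joint mass
  function.\<close>

lemma pmf_coupling_of_hall:
  assumes X: "finite X" "set_pmf p \<subseteq> X" and Y: "finite Y" "set_pmf q \<subseteq> Y"
    and hall: "\<And>F. F \<subseteq> X \<Longrightarrow> measure_pmf.prob p F \<le> measure_pmf.prob q {y\<in>Y. \<exists>x\<in>F. R x y}"
  shows "\<exists>Q. is_coupling Q p q \<and> (\<forall>(x, y)\<in>set_pmf Q. R x y)"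
proof -
  have "\<exists>c. (\<forall>x y. c x y \<ge> 0) \<and> (\<forall>x y. c x y \<noteq> 0 \<longrightarrow> x \<in> X \<and> y \<in> Y \<and> R x y) \<and>
      (\<forall>x\<in>X. sum (c x) Y = pmf p x) \<and> (\<forall>y\<in>Y. (\<Sum>x\<in>X. c x y) = pmf q y)"
  proof (rule weighted_hall)
    show "sum (pmf p) X = sum (pmf q) Y" using X Y by (simp add: sum_pmf_eq_1)
    fix F assume F: "F \<subseteq> X"
    then have "finite F" using X finite_subset by blast
    with hall[OF F] show "sum (pmf p) F \<le> sum (pmf q) {y\<in>Y. \<exists>x\<in>F. R x y}"
      using Y by (simp add: measure_measure_pmf_finite)
  qed (use X Y in auto)
  then obtain c where c0: "\<And>x y. c x y \<ge> 0"
    and supp: "\<And>x y. c x y \<noteq> 0 \<Longrightarrow> x \<in> X \<and> y \<in> Y \<and> R x y"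
    and cX: "\<And>x. x \<in> X \<Longrightarrow> sum (c x) Y = pmf p x"
    and cY: "\<And>y. y \<in> Y \<Longrightarrow> (\<Sum>x\<in>X. c x y) = pmf q y" by blast
  let ?c = "\<lambda>(x, y). c x y"
  define Q where "Q = embed_pmf ?c"
  have nonneg: "0 \<le> ?c z" for z using c0 by (cases z) simp
  have "(\<integral>\<^sup>+z. ?c z \<partial>count_space UNIV) = (\<Sum>z\<in>X \<times> Y. ennreal (?c z))"
  proof (rule nn_integral_count_space')
    fix z assume "z \<notin> X \<times> Y"
    then have "c (fst z) (snd z) = 0" using supp by (metis mem_Times_iff)
    then show "ennreal (?c z) = 0" by (simp add: case_prod_beta)
  qed (use X Y in auto)
  also have "\<dots> = ennreal (\<Sum>z\<in>X \<times> Y. ?c z)"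
    by (rule sum_ennreal) (rule nonneg)
  also have "(\<Sum>z\<in>X \<times> Y. ?c z) = sum (pmf p) X"
    by (simp add: cX flip: sum.cartesian_product)
  finally have one: "(\<integral>\<^sup>+z. ?c z \<partial>count_space UNIV) = 1"
    using X by (simp add: sum_pmf_eq_1)
  have pmfQ: "pmf Q (x, y) = c x y" for x y
    unfolding Q_def using pmf_embed_pmf[of ?c, OF nonneg one] by simp
  have setQ: "x \<in> X \<and> y \<in> Y \<and> R x y" if "(x, y) \<in> set_pmf Q" for x y
    using that supp by (auto simp: set_pmf_iff pmfQ)
  have "map_pmf fst Q = p"
  proof (rule pmf_eqI)
    fix x
    \<comment> \<open>The fibre of \<open>fst\<close> over \<open>x\<close> meets the support of
      \<open>Q\<close> only inside \<open>{x} \<times> Y\<close>, which turns its probability into a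
      finite sum.\<close>
    have "pmf (map_pmf fst Q) x = measure_pmf.prob Q (({x} \<times> Y) \<inter> set_pmf Q)"
      unfolding pmf_map measure_Int_set_pmf[of Q "fst -` {x}", symmetric]
      using setQ by (intro arg_cong[of _ _ "measure_pmf.prob Q"]) auto
    also have "\<dots> = (\<Sum>z\<in>{x} \<times> Y. pmf Q z)"
      unfolding measure_Int_set_pmf using Y by (intro measure_measure_pmf_finite) simp
    also have "\<dots> = (\<Sum>y\<in>Y. c x y)"
      by (simp add: pmfQ sum.cartesian_product')
    also have "\<dots> = pmf p x"
    proof (cases "x \<in> X")
      case False
      then have "c x y = 0" for y using supp by blast
      then show ?thesis using False X by (auto simp: pmf_eq_0_set_pmf)
    qed (rule cX)
    finally show "pmf (map_pmf fst Q) x = pmf p x" .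
  qed
  moreover have "map_pmf snd Q = q"
  proof (rule pmf_eqI)
    fix y
    have "pmf (map_pmf snd Q) y = measure_pmf.prob Q ((X \<times> {y}) \<inter> set_pmf Q)"
      unfolding pmf_map measure_Int_set_pmf[of Q "snd -` {y}", symmetric]
      using setQ by (intro arg_cong[of _ _ "measure_pmf.prob Q"]) auto
    also have "\<dots> = (\<Sum>z\<in>X \<times> {y}. pmf Q z)"
      unfolding measure_Int_set_pmf using X by (intro measure_measure_pmf_finite) simp
    also have "\<dots> = (\<Sum>x\<in>X. c x y)"
      by (simp add: pmfQ sum.cartesian_product')
    also have "\<dots> = pmf q y"
    proof (cases "y \<in> Y")
      case False
      then have "c x y = 0" for x using supp by blast
      then show ?thesis using False Y by (auto simp: pmf_eq_0_set_pmf)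
    qed (rule cY)
    finally show "pmf (map_pmf snd Q) y = pmf q y" .
  qed
  ultimately show ?thesis using setQ by (auto simp: is_coupling_def)
qed

theorem theorem7p3:
  fixes A :: "real mat" and n i :: nat
  assumes "A \<in> carrier_mat n n"
    and "skew_symmetric_mat A"
    and "i < n"
    and "measure_pmf.prob (principal_det_pmf A) {S. i \<notin> S} > 0"
    and "measure_pmf.prob (principal_det_pmf A) {S. i \<in> S} > 0"
  shows "\<exists>Q :: (nat set \<times> nat set) pmf.
    is_coupling Q (cond_pmf (principal_det_pmf A) {S. i \<notin> S})
                  (cond_pmf (principal_det_pmf A) {S. i \<in> S}) \<and>
    (AE (S0, S1) in measure_pmf Q. i \<notin> S0 \<and> i \<in> S1 \<and> card (sym_diff S0 S1) = 2)"
proof -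
  note A = assms(1,2)
  \<comment> \<open>Extended by zero, \<open>a\<close> is skew on all pairs of naturals, so the
    Pfaffian lemmas carry no range conditions.\<close>
  define a where "a = (\<lambda>k l. if k < n \<and> l < n then A $$ (k, l) else 0)"
  have skew: "a k l = - a l k" for k l
  proof (cases "k < n \<and> l < n")
    case True
    then have "A $$ (k, l) = transpose_mat A $$ (l, k)" using A(1) by simp
    also have "\<dots> = - A $$ (l, k)" using True A unfolding skew_symmetric_mat_def by simp
    finally show ?thesis using True by (simp add: a_def)
  qed (auto simp: a_def)
  have det: "principal_det A S = (pfaffian a S)\<^sup>2" if "S \<subseteq> {..<n}" for S
    by (rule principal_det_eq_pfaffian_power2[of A n S a, OF A(1) that skew]) (simp add: a_def)
  define V where "V = {..<n} - {i}"
  have V: "finite V" "i \<notin> V" "insert i V = {..<n}" using assms(3) by (auto simp: V_def)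
  obtain u where u: "\<And>k. k \<in> V \<Longrightarrow> a i k = u k + (\<Sum>j\<in>V. a j k * u j)"
  proof -
    \<comment> \<open>Zeroing row and column \<open>i\<close> keeps the index range
      \<open>{..<n}\<close> while restricting the system to \<open>V\<close>, so \<open>V\<close> is
      not renumbered.\<close>
    let ?a = "\<lambda>k l. if k = i \<or> l = i then 0 else a k l"
    have skew': "?a k l = - ?a l k" for k l by (cases "k = i \<or> l = i") (auto intro: skew)
    have "0 < (\<Sum>S\<in>Pow {..<n}. (pfaffian ?a S)\<^sup>2)" by (rule sum_pfaffian_power2_pos) simp
    then have "Determinant.det (shift_mat ?a n 1) \<noteq> 0"
      unfolding sum_pfaffian_power2[of ?a n, OF skew'] by (rule less_imp_neq[symmetric])
    from shift_mat_solvable[OF this, of "a i"]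
    obtain u where u: "\<And>k. k < n \<Longrightarrow> a i k = u k + (\<Sum>j<n. ?a j k * u j)" by blast
    have "a i k = u k + (\<Sum>j\<in>V. a j k * u j)" if k: "k \<in> V" for k
    proof -
      have "(\<Sum>j<n. ?a j k * u j) = (\<Sum>j\<in>V. ?a j k * u j)"
        by (rule sum.mono_neutral_right) (auto simp: V_def)
      also have "\<dots> = (\<Sum>j\<in>V. a j k * u j)"
        using k by (intro sum.cong) (auto simp: V_def)
      finally show ?thesis using u[of k] k by (simp add: V_def)
    qed
    then show ?thesis by (rule that)
  qed
  have pfaffian_insert: "(pfaffian a (insert i T))\<^sup>2 = (clifford u V (pfaffian a) T)\<^sup>2" if "T \<in> Pow V" for T
  proof -
    have "clifford u V (pfaffian a) T = koszul_sign i T * pfaffian a (insert i T)"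
      using that u by (intro clifford_pfaffian[of a, OF skew V(1,2), symmetric]) auto
    then show ?thesis by (simp add: power_mult_distrib power2_eq_square[of "koszul_sign i T"])
  qed
  define s where "s = (\<Sum>k\<in>V. (u k)\<^sup>2)"
  define Z where "Z = (\<Sum>S\<in>Pow V. (pfaffian a S)\<^sup>2)"
  define W where "W = (\<Sum>T\<in>Pow {..<n}. principal_det A T)"
  have W: "W > 0"
    unfolding W_def using sum_pfaffian_power2_pos[of "{..<n}" a] by (simp add: det)
  have mu: "pmf (principal_det_pmf A) S = (if S \<subseteq> {..<n} then (pfaffian a S)\<^sup>2 / W else 0)" for S
    using pmf_principal_det_pmf[OF A] by (simp add: det W_def)
  let ?mu = "principal_det_pmf A"
  let ?p = "cond_pmf ?mu {S. i \<notin> S}" and ?q = "cond_pmf ?mu {S. i \<in> S}"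
  let ?X = "Pow V" and ?Y = "insert i ` Pow V"
  let ?R = "\<lambda>S0 S1. i \<notin> S0 \<and> i \<in> S1 \<and> card (sym_diff S0 S1) = 2"
  have set_mu: "set_pmf ?mu \<subseteq> Pow {..<n}" by (auto simp: set_pmf_iff mu split: if_splits)
  have inj: "inj_on (insert i) (Pow V)" using V(2) by (auto simp: inj_on_def)
  have set_p: "set_pmf ?mu \<inter> {S. i \<notin> S} \<subseteq> ?X"
    using set_mu by (auto simp: V_def)
  have set_q: "set_pmf ?mu \<inter> {S. i \<in> S} \<subseteq> ?Y"
  proof
    fix S assume "S \<in> set_pmf ?mu \<inter> {S. i \<in> S}"
    then have "S = insert i (S - {i})" "S - {i} \<in> Pow V" using set_mu by (auto simp: V_def)
    then show "S \<in> ?Y" by blast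
  qed
  have prob0: "measure_pmf.prob ?mu {S. i \<notin> S} = Z / W"
  proof -
    have "measure_pmf.prob ?mu {S. i \<notin> S} = measure_pmf.prob ?mu ?X"
      using set_p V by (intro measure_pmf.finite_measure_eq_AE) (auto simp: AE_measure_pmf_iff)
    also have "\<dots> = Z / W"
      using V by (subst measure_measure_pmf_finite)
        (auto simp: Z_def sum_divide_distrib mu V_def intro!: sum.cong)
    finally show ?thesis .
  qed
  \<comment> \<open>By the norm identity, the sets containing \<open>i\<close> carry
    \<open>s\<close> times the mass of the others.\<close>
  have prob1: "measure_pmf.prob ?mu {S. i \<in> S} = s * Z / W"
  proof -
    have "measure_pmf.prob ?mu {S. i \<in> S} = measure_pmf.prob ?mu ?Y"
      using set_q by (intro measure_pmf.finite_measure_eq_AE) (auto simp: AE_measure_pmf_iff)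
    also have "\<dots> = (\<Sum>T\<in>Pow V. pmf ?mu (insert i T))"
      using V by (simp add: measure_measure_pmf_finite sum.reindex[OF inj])
    also have "\<dots> = (\<Sum>T\<in>Pow V. (clifford u V (pfaffian a) T)\<^sup>2 / W)"
      using V(3) by (intro sum.cong[OF refl]) (auto simp: mu pfaffian_insert)
    also have "\<dots> = s * Z / W"
      by (simp add: clifford_norm[OF V(1)] s_def Z_def flip: sum_divide_distrib)
    finally show ?thesis .
  qed
  have Z: "Z > 0" unfolding Z_def by (rule sum_pfaffian_power2_pos[OF V(1)])
  \<comment> \<open>Positive mass on the sets containing \<open>i\<close> forces \<open>u\<close> to
    be nonzero on \<open>V\<close>, which permits division by \<open>s\<close>.\<close>
  have s: "s > 0" using assms(5) Z W by (simp add: prob1 zero_less_mult_iff zero_less_divide_iff)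
  have ne: "set_pmf ?mu \<inter> {S. i \<notin> S} \<noteq> {}" "set_pmf ?mu \<inter> {S. i \<in> S} \<noteq> {}"
    using assms(4,5) measure_Int_set_pmf[of ?mu "{S. i \<notin> S}"] measure_Int_set_pmf[of ?mu "{S. i \<in> S}"]
    by (auto simp: Int_commute)
  have p: "pmf ?p S = (pfaffian a S)\<^sup>2 / Z" if "S \<in> Pow V" for S
    using that V W by (auto simp: pmf_cond[OF ne(1)] prob0 mu V_def)
  have q: "pmf ?q (insert i T) = (clifford u V (pfaffian a) T)\<^sup>2 / (s * Z)" if "T \<in> Pow V" for T
    using that V(3) W by (auto simp: pmf_cond[OF ne(2)] prob1 mu pfaffian_insert)
  have "\<exists>Q. is_coupling Q ?p ?q \<and> (\<forall>(S0, S1)\<in>set_pmf Q. ?R S0 S1)"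
  proof (rule pmf_coupling_of_hall)
    fix F assume F: "F \<subseteq> ?X"
    define N where "N = {T \<in> Pow V. \<exists>S\<in>F. \<exists>k\<in>V. T = flip k S}"
    have fin: "finite F" "finite N"
      using F V(1) finite_subset[of F "Pow V"] by (auto simp: N_def)
    have "measure_pmf.prob ?p F = (\<Sum>S\<in>F. (pfaffian a S)\<^sup>2) / Z"
      unfolding measure_measure_pmf_finite[OF fin(1)] sum_divide_distrib
      using F p by (intro sum.cong) auto
    \<comment> \<open>Division by \<open>s * Z\<close> normalises both laws at once and absorbs the
      factor \<open>s\<close> of \<open>clifford_hall\<close>.\<close>
    also have "\<dots> \<le> (\<Sum>T\<in>N. (clifford u V (pfaffian a) T)\<^sup>2) / (s * Z)"
      using clifford_hall[OF V(1) F, of u "pfaffian a"] s Z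
      unfolding N_def s_def[symmetric] by (simp add: field_simps)
    also have "\<dots> = (\<Sum>T\<in>N. pmf ?q (insert i T))"
      unfolding sum_divide_distrib by (intro sum.cong) (auto simp: q N_def)
    also have "\<dots> = measure_pmf.prob ?q (insert i ` N)"
    proof -
      have "inj_on (insert i) N" using inj by (rule inj_on_subset) (auto simp: N_def)
      then show ?thesis
        by (simp only: measure_measure_pmf_finite[OF finite_imageI[OF fin(2)]] sum.reindex comp_def)
    qed
    also have "\<dots> \<le> measure_pmf.prob ?q {S1\<in>?Y. \<exists>S0\<in>F. ?R S0 S1}"
    proof (rule measure_pmf.finite_measure_mono)
      show "insert i ` N \<subseteq> {S1\<in>?Y. \<exists>S0\<in>F. ?R S0 S1}"
      proof
        fix S1 assume "S1 \<in> insert i ` N"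
        then obtain S k where S: "S \<in> F" "k \<in> V" "flip k S \<in> Pow V" "S1 = insert i (flip k S)"
          unfolding N_def by blast
        \<comment> \<open>\<open>S1\<close> arises from \<open>S\<close> by toggling
          \<open>k\<close> and adding \<open>i\<close>; as these are distinct, the two sets differ
          in exactly two elements.\<close>
        have "i \<notin> S" "i \<noteq> k" using S F V(2) by auto
        then have "sym_diff S S1 = {i, k}" using S(4) by (auto simp: flip_def)
        then show "S1 \<in> {S1\<in>?Y. \<exists>S0\<in>F. ?R S0 S1}"
          using S \<open>i \<notin> S\<close> \<open>i \<noteq> k\<close> by (auto intro!: bexI[of _ S])
      qed
    qed simp
    finally show "measure_pmf.prob ?p F \<le> measure_pmf.prob ?q {S1\<in>?Y. \<exists>S0\<in>F. ?R S0 S1}" .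
  qed (use V set_p set_q ne in auto)
  then show ?thesis by (simp add: AE_measure_pmf_iff)
qed

end
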